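(* There is an absolute constant $c>0$ such that for every sufficiently large $n$ there is an instance of the Generalized Makespan Problem with $n$ jobs, in which every machine has the same symmetric monotone inner norm $\psi$, for which the configuration LP is feasible with threshold $T=2$, while every assignment $\rho$ of the jobs to the machines has generalized makespan at least $c\sqrt{\log n}$. In other words, the natural configuration LP for the Generalized Makespan Problem has integrality gap $\Omega((\log n)^{1/2})$.
   Context: A norm $\phi:\mathbb{R}^k\to\mathbb{R}_{\ge 0}$ is symmetric if $\phi(u)=\phi(u')$ whenever $u'$ is a permutation of $u$. It is monotone if $\phi(u)\le\phi(v)$ whenever $0\le u(i)\le v(i)$ for all $i$. The top-$k$ norm of a nonnegative vector is the sum of its $k$ largest entries. Generalized Makespan Problem (GMP). We are given a set $J$ of $n$ jobs, a set $M$ of $m$ machines, processing times $p_{ij}\in[0,\infty]$ for each machine $i$ and job $j$ (the value $\infty$ means job $j$ cannot usefully be placed on $i$), and a symmetric monotone norm $\psi_i:\mathbb{R}^n\to\mathbb{R}_{\ge 0}$ for each machine $i$. For $C\subseteq J$, let $p_i[C]$ be the vector $(p_{ij}\mathbb{1}[j\in C])_{j\in J}$, and write $\psi_i(C)=\psi_i(p_i[C])$. Given an assignment $\rho:J\to M$, the load of machine $i$ is $\psi_i(\rho^{-1}(i))$. The generalized makespan is $\max_i \psi_i(\rho^{-1}(i))$. The goal is to minimize the generalized makespan. Configuration LP with threshold $T$: this is the feasibility problem in variables $x_{i,C}\ge 0$, for $i\in M$ and $C\subseteq J$, subject to three conditions: - $\sum_{C\subseteq J}x_{i,C}\le 1$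 for every $i\in M$; - $\sum_{i\in M}\sum_{C\ni j}x_{i,C}=1$ for every $j\in J$; - $x_{i,C}=0$ whenever $\psi_i(C)>T$. *)

theory Defs
  imports
    Complex_Main
    "HOL-Library.FuncSet"
    "HOL-Library.Extended_Nonnegative_Real"
    "HOL-Combinatorics.Permutations"
    "Jordan_Normal_Form.Matrix"
begin

definition norm_on_Rn :: "nat \<Rightarrow> (real vec \<Rightarrow> real) \<Rightarrow> bool" where
  "norm_on_Rn n \<phi> \<longleftrightarrow>
     (\<forall>u\<in>carrier_vec n. 0 \<le> \<phi> u) \<and>
     (\<forall>u\<in>carrier_vec n. \<phi> u = 0 \<longleftrightarrow> u = 0\<^sub>v n) \<and>
     (\<forall>u\<in>carrier_vec n. \<forall>a. \<phi> (a \<cdot>\<^sub>v u) = \<bar>a\<bar> * \<phi> u) \<and>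
     (\<forall>u\<in>carrier_vec n. \<forall>v\<in>carrier_vec n. \<phi> (u + v) \<le> \<phi> u + \<phi> v)"

definition symmetric_on_Rn :: "nat \<Rightarrow> (real vec \<Rightarrow> real) \<Rightarrow> bool" where
  "symmetric_on_Rn n \<phi> \<longleftrightarrow>
     (\<forall>u\<in>carrier_vec n. \<forall>\<pi>. \<pi> permutes {..<n} \<longrightarrow> \<phi> (vec n (\<lambda>i. u $ \<pi> i)) = \<phi> u)"

definition monotone_on_Rn :: "nat \<Rightarrow> (real vec \<Rightarrow> real) \<Rightarrow> bool" where
  "monotone_on_Rn n \<phi> \<longleftrightarrow>
     (\<forall>u\<in>carrier_vec n. \<forall>v\<in>carrier_vec n.
        (\<forall>i<n. 0 \<le> u $ i \<and> u $ i \<le> v $ i) \<longrightarrow> \<phi> u \<le> \<phi> v)"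

text \<open>The jobs are \<open>{..<n_jobs I}\<close> and the machines are \<open>{..<n_machines I}\<close>; values of
  \<open>ptime I\<close> and \<open>inner_norm I\<close> at other indices are irrelevant.\<close>

record gmp_instance =
  n_jobs :: nat
  n_machines :: nat
  ptime :: "nat \<Rightarrow> nat \<Rightarrow> ennreal"
  inner_norm :: "nat \<Rightarrow> real vec \<Rightarrow> real"

definition is_gmp :: "gmp_instance \<Rightarrow> bool" where
  "is_gmp I \<longleftrightarrow>
     (\<forall>i<n_machines I. norm_on_Rn (n_jobs I) (inner_norm I i) \<and>
        symmetric_on_Rn (n_jobs I) (inner_norm I i) \<and>
        monotone_on_Rn (n_jobs I) (inner_norm I i))"

text \<open>A norm is extended to \<open>[0,\<infinity>]\<close>-valued vectors by the value \<open>\<infinity>\<close> as soon as one of the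
  entries is \<open>\<infinity>\<close>.\<close>

definition ext_norm :: "nat \<Rightarrow> (real vec \<Rightarrow> real) \<Rightarrow> (nat \<Rightarrow> ennreal) \<Rightarrow> ennreal" where
  "ext_norm n \<phi> u =
     (if \<exists>j<n. u j = \<infinity> then \<infinity> else ennreal (\<phi> (vec n (\<lambda>j. enn2real (u j)))))"

definition set_load :: "gmp_instance \<Rightarrow> nat \<Rightarrow> nat set \<Rightarrow> ennreal" where
  "set_load I i C =
     ext_norm (n_jobs I) (inner_norm I i) (\<lambda>j. if j \<in> C then ptime I i j else 0)"

definition assignments :: "gmp_instance \<Rightarrow> (nat \<Rightarrow> nat) set" where
  "assignments I = {..<n_jobs I} \<rightarrow> {..<n_machines I}"

definition makespan :: "gmp_instance \<Rightarrow> (nat \<Rightarrow> nat) \<Rightarrow> ennreal" where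
  "makespan I \<rho> = (MAX i\<in>{..<n_machines I}. set_load I i {j\<in>{..<n_jobs I}. \<rho> j = i})"

definition config_lp_feasible :: "gmp_instance \<Rightarrow> ennreal \<Rightarrow> bool" where
  "config_lp_feasible I T \<longleftrightarrow>
     (\<exists>x :: nat \<Rightarrow> nat set \<Rightarrow> real.
        (\<forall>i<n_machines I. \<forall>C\<subseteq>{..<n_jobs I}. 0 \<le> x i C) \<and>
        (\<forall>i<n_machines I. (\<Sum>C\<in>Pow {..<n_jobs I}. x i C) \<le> 1) \<and>
        (\<forall>j<n_jobs I. (\<Sum>i<n_machines I. \<Sum>C\<in>{C\<in>Pow {..<n_jobs I}. j \<in> C}. x i C) = 1) \<and>
        (\<forall>i<n_machines I. \<forall>C\<subseteq>{..<n_jobs I}. T < set_load I i C \<longrightarrow> x i C = 0))"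

definition opt_makespan :: "gmp_instance \<Rightarrow> ennreal" where
  "opt_makespan I = (INF \<rho>\<in>assignments I. makespan I \<rho>)"

definition config_lp_bound :: "gmp_instance \<Rightarrow> ennreal" where
  "config_lp_bound I = Inf {T. config_lp_feasible I T}"

text \<open>With the \<open>ennreal\<close> conventions \<open>0 / 0 = 0\<close> and \<open>\<infinity> / \<infinity> = 0\<close>, trivial instances and
  instances without a finite feasible threshold do not contribute to the supremum.\<close>

definition config_lp_gap :: "nat \<Rightarrow> ennreal" where
  "config_lp_gap n =
     (SUP I\<in>{I. is_gmp I \<and> n_jobs I = n}. opt_makespan I / config_lp_bound I)"

end

theory Submission
  imports Defs
begin

text \<open>
  There are \<open>2r\<close> machines and \<open>r\<close> classes of jobs. For every class \<open>l < r\<close> and every set \<open>e\<close> of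
  \<open>r\<close> machines there are \<open>r Q\<^sup>l\<close> jobs that can only run on \<open>e\<close>, with processing time
  proportional to \<open>2\<^sup>-\<^sup>l\<close>. The norm is \<open>\<Sum>\<^sub>t (2/Q)\<^sup>t Top\<^bsub>Q^t\<^esub>\<close>, where \<open>Q = 32\<^sup>r\<close>. A machine carries
  all its jobs of a single class at constant load, so giving weight \<open>1/r\<close> to each such
  configuration solves the LP. But as few as \<open>Q\<^sup>l\<close> jobs of class \<open>l\<close> already produce constant
  load, and the loads of the classes add up. In an assignment, the machines that have at least
  \<open>Q\<^sup>l\<close> jobs of class \<open>l\<close> must meet every \<open>r\<close>-set of machines, so there are more than \<open>r\<close> of
  them; averaging over the classes, some machine is loaded by half of the classes and has load
  \<open>\<Omega>(r)\<close>. The number of jobs is at most \<open>2\<close> to the power \<open>9 r\<^sup>2\<close>.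
\<close>

section \<open>Sums of top-k norms\<close>

text \<open>A maximum over index sets instead of a sorted list: subadditivity and symmetry can then
  be checked one set at a time. Allowing fewer than \<open>k\<close> indices keeps the family
  nonempty for every \<open>k\<close>; absolute values extend the norm to vectors of any
  sign.\<close>

definition top_sum :: "nat \<Rightarrow> nat \<Rightarrow> real vec \<Rightarrow> real" where
  "top_sum n k u = (MAX K\<in>{K. K \<subseteq> {..<n} \<and> card K \<le> k}. \<Sum>j\<in>K. \<bar>u $ j\<bar>)"

lemma finite_top_sets: "finite {K. K \<subseteq> {..<n::nat} \<and> card K \<le> k}"
  by (rule finite_subset[of _ "Pow {..<n}"]) auto

lemma sum_le_top_sum:
  assumes "K \<subseteq> {..<n}" "card K \<le> k"
  shows "(\<Sum>j\<in>K. \<bar>u $ j\<bar>) \<le> top_sum n k u"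
  unfolding top_sum_def using assms finite_top_sets[of n k] by (intro Max_ge) auto

lemma top_sum_attained:
  obtains K where "K \<subseteq> {..<n}" "card K \<le> k" "top_sum n k u = (\<Sum>j\<in>K. \<bar>u $ j\<bar>)"
proof -
  let ?F = "{K. K \<subseteq> {..<n} \<and> card K \<le> k}"
  have "{} \<in> ?F" by simp
  then have "top_sum n k u \<in> (\<lambda>K. \<Sum>j\<in>K. \<bar>u $ j\<bar>) ` ?F"
    unfolding top_sum_def using finite_top_sets[of n k] by (intro Max_in) blast+
  then show thesis using that by auto
qed

lemma top_sum_leI:
  assumes "\<And>K. K \<subseteq> {..<n} \<Longrightarrow> card K \<le> k \<Longrightarrow> (\<Sum>j\<in>K. \<bar>u $ j\<bar>) \<le> b"
  shows "top_sum n k u \<le> b"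
  by (rule top_sum_attained[of n k u]) (use assms in auto)

lemma top_sum_nonneg: "0 \<le> top_sum n k u"
  using sum_le_top_sum[of "{}" n k u] by simp

lemma top_sum_mono:
  assumes "\<And>i. i < n \<Longrightarrow> \<bar>u $ i\<bar> \<le> \<bar>v $ i\<bar>"
  shows "top_sum n k u \<le> top_sum n k v"
proof (rule top_sum_leI)
  fix K assume K: "K \<subseteq> {..<n}" "card K \<le> k"
  have "(\<Sum>j\<in>K. \<bar>u $ j\<bar>) \<le> (\<Sum>j\<in>K. \<bar>v $ j\<bar>)"
    using K assms by (intro sum_mono) auto
  also have "\<dots> \<le> top_sum n k v" using K by (rule sum_le_top_sum)
  finally show "(\<Sum>j\<in>K. \<bar>u $ j\<bar>) \<le> top_sum n k v" .
qed

lemma top_sum_add: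
  assumes "u \<in> carrier_vec n" "v \<in> carrier_vec n"
  shows "top_sum n k (u + v) \<le> top_sum n k u + top_sum n k v"
proof (rule top_sum_leI)
  fix K assume K: "K \<subseteq> {..<n}" "card K \<le> k"
  have "(\<Sum>j\<in>K. \<bar>(u + v) $ j\<bar>) \<le> (\<Sum>j\<in>K. \<bar>u $ j\<bar> + \<bar>v $ j\<bar>)"
    using K assms by (intro sum_mono) (auto simp: abs_triangle_ineq)
  also have "\<dots> = (\<Sum>j\<in>K. \<bar>u $ j\<bar>) + (\<Sum>j\<in>K. \<bar>v $ j\<bar>)" by (rule sum.distrib)
  also have "\<dots> \<le> top_sum n k u + top_sum n k v"
    using K by (intro add_mono sum_le_top_sum)
  finally show "(\<Sum>j\<in>K. \<bar>(u + v) $ j\<bar>) \<le> top_sum n k u + top_sum n k v" .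
qed

lemma top_sum_smult:
  assumes "u \<in> carrier_vec n"
  shows "top_sum n k (a \<cdot>\<^sub>v u) = \<bar>a\<bar> * top_sum n k u"
proof -
  have sum_eq: "(\<Sum>j\<in>K. \<bar>(a \<cdot>\<^sub>v u) $ j\<bar>) = \<bar>a\<bar> * (\<Sum>j\<in>K. \<bar>u $ j\<bar>)" if "K \<subseteq> {..<n}" for K
    unfolding sum_distrib_left using that assms by (intro sum.cong) (auto simp: abs_mult)
  show ?thesis
  proof (rule antisym)
    show "top_sum n k (a \<cdot>\<^sub>v u) \<le> \<bar>a\<bar> * top_sum n k u"
      by (rule top_sum_leI) (simp add: sum_eq mult_left_mono sum_le_top_sum)
    obtain K where K: "K \<subseteq> {..<n}" "card K \<le> k" "top_sum n k u = (\<Sum>j\<in>K. \<bar>u $ j\<bar>)"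
      by (rule top_sum_attained)
    then show "\<bar>a\<bar> * top_sum n k u \<le> top_sum n k (a \<cdot>\<^sub>v u)"
      using sum_le_top_sum[of K n k "a \<cdot>\<^sub>v u"] by (simp add: sum_eq)
  qed
qed

lemma top_sum_permute_le:
  assumes "\<pi> permutes {..<n}"
  shows "top_sum n k (vec n (\<lambda>i. u $ \<pi> i)) \<le> top_sum n k u"
proof (rule top_sum_leI)
  fix K assume K: "K \<subseteq> {..<n}" "card K \<le> k"
  have inj: "inj_on \<pi> K" using permutes_inj[OF assms] by (rule inj_on_subset) simp
  have "(\<Sum>j\<in>K. \<bar>vec n (\<lambda>i. u $ \<pi> i) $ j\<bar>) = (\<Sum>j\<in>K. \<bar>u $ \<pi> j\<bar>)"
    using K by (intro sum.cong) auto
  also have "\<dots> = (\<Sum>j\<in>\<pi> ` K. \<bar>u $ j\<bar>)" by (simp add: sum.reindex[OF inj])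
  also have "\<dots> \<le> top_sum n k u"
  proof (rule sum_le_top_sum)
    show "\<pi> ` K \<subseteq> {..<n}" using K permutes_image[OF assms] by blast
    show "card (\<pi> ` K) \<le> k" using K by (simp add: card_image[OF inj])
  qed
  finally show "(\<Sum>j\<in>K. \<bar>vec n (\<lambda>i. u $ \<pi> i) $ j\<bar>) \<le> top_sum n k u" .
qed

text \<open>The one-sided bound holds for every permutation. Applied to the inverse and the permuted
  vector, it gives the reverse inequality.\<close>

lemma top_sum_permute:
  assumes "\<pi> permutes {..<n}" "u \<in> carrier_vec n"
  shows "top_sum n k (vec n (\<lambda>i. u $ \<pi> i)) = top_sum n k u"
proof (rule antisym)
  show "top_sum n k (vec n (\<lambda>i. u $ \<pi> i)) \<le> top_sum n k u"
    using assms(1) by (rule top_sum_permute_le)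
  let ?v = "vec n (\<lambda>i. u $ \<pi> i)"
  have inv: "inv_into UNIV \<pi> permutes {..<n}" using assms(1) by (rule permutes_inv)
  have "vec n (\<lambda>i. ?v $ inv_into UNIV \<pi> i) = u"
  proof (rule eq_vecI)
    fix i assume "i < dim_vec u"
    then have "i < n" using assms(2) by simp
    moreover from this have "inv_into UNIV \<pi> i < n" using permutes_in_image[OF inv, of i] by simp
    ultimately show "vec n (\<lambda>i. ?v $ inv_into UNIV \<pi> i) $ i = u $ i"
      by (simp add: permutes_inverses[OF assms(1)])
  qed (use assms(2) in simp)
  then show "top_sum n k u \<le> top_sum n k ?v"
    using top_sum_permute_le[OF inv, of k ?v] by simp
qed

text \<open>Only indices in \<open>K \<inter> C\<close> contribute to the sum over \<open>K\<close>,
  each at most \<open>p\<close>, and their number is bounded by both \<open>k\<close> and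
  \<open>card C\<close>.\<close>

lemma top_sum_le_of_support:
  assumes "finite C" "\<And>j. j < n \<Longrightarrow> j \<notin> C \<Longrightarrow> u $ j = 0" "\<And>j. j < n \<Longrightarrow> \<bar>u $ j\<bar> \<le> p" "0 \<le> p"
  shows "top_sum n k u \<le> p * real (min k (card C))"
proof (rule top_sum_leI)
  fix K assume K: "K \<subseteq> {..<n}" "card K \<le> k"
  have fin: "finite K" using K finite_subset by blast
  have "(\<Sum>j\<in>K. \<bar>u $ j\<bar>) = (\<Sum>j\<in>K \<inter> C. \<bar>u $ j\<bar>)"
    using K assms(2) fin by (intro sum.mono_neutral_right) auto
  also have "\<dots> \<le> real (card (K \<inter> C)) * p"
    using K assms(3) by (intro sum_bounded_above) auto
  also have "card (K \<inter> C) \<le> min k (card C)"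
    using K card_mono[OF fin, of "K \<inter> C"] card_mono[OF assms(1), of "K \<inter> C"] by simp
  then have "real (card (K \<inter> C)) * p \<le> p * real (min k (card C))"
    using assms(4) by (metis mult.commute mult_left_mono of_nat_mono)
  finally show "(\<Sum>j\<in>K. \<bar>u $ j\<bar>) \<le> p * real (min k (card C))" .
qed

section \<open>Weighted sums of top-k norms\<close>

definition top_mix :: "nat \<Rightarrow> nat \<Rightarrow> (nat \<Rightarrow> real) \<Rightarrow> (nat \<Rightarrow> nat) \<Rightarrow> real vec \<Rightarrow> real" where
  "top_mix n r w k u = (\<Sum>t<r. w t * top_sum n (k t) u)"

lemma norm_on_Rn_top_mix:
  assumes "0 < r" "\<And>t. t < r \<Longrightarrow> 0 < w t" "\<And>t. t < r \<Longrightarrow> 0 < k t"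
  shows "norm_on_Rn n (top_mix n r w k)"
  unfolding norm_on_Rn_def
proof (intro conjI ballI allI)
  fix u :: "real vec" assume u: "u \<in> carrier_vec n"
  show nonneg: "0 \<le> top_mix n r w k u"
    unfolding top_mix_def using assms(2)
    by (intro sum_nonneg mult_nonneg_nonneg top_sum_nonneg) (auto simp: less_imp_le)
  show "top_mix n r w k (a \<cdot>\<^sub>v u) = \<bar>a\<bar> * top_mix n r w k u" for a
    unfolding top_mix_def sum_distrib_left top_sum_smult[OF u]
    by (intro sum.cong) auto
  show "top_mix n r w k (u + v) \<le> top_mix n r w k u + top_mix n r w k v"
    if v: "v \<in> carrier_vec n" for v
    unfolding top_mix_def sum.distrib[symmetric] distrib_left[symmetric]
    using assms(2) by (intro sum_mono mult_left_mono top_sum_add u v) (auto simp: less_imp_le)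
  show "top_mix n r w k u = 0 \<longleftrightarrow> u = 0\<^sub>v n"
  proof
    assume "u = 0\<^sub>v n"
    then have "u = 0 \<cdot>\<^sub>v u" using u by auto
    then show "top_mix n r w k u = 0"
      using top_sum_smult[OF u, of _ 0] by (simp add: top_mix_def)
  next
    assume zero: "top_mix n r w k u = 0"
    \<comment> \<open>The summand \<open>t = 0\<close> alone yields definiteness: since
      \<open>k 0\<close> is positive, its top sum dominates the absolute value of every single
      entry.\<close>
    have "w 0 * top_sum n (k 0) u = 0"
      using zero assms sum_nonneg_0[of "{..<r}" "\<lambda>t. w t * top_sum n (k t) u" 0]
      by (force simp: top_mix_def top_sum_nonneg less_imp_le)
    then have "top_sum n (k 0) u = 0" using assms(1) assms(2)[of 0] by simp
    then have "\<bar>u $ j\<bar> \<le> 0" if "j < n" for j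
      using sum_le_top_sum[of "{j}" n "k 0" u] that assms(1) assms(3)[of 0] by simp
    then show "u = 0\<^sub>v n" using u by (intro eq_vecI) auto
  qed
qed

lemma symmetric_on_Rn_top_mix: "symmetric_on_Rn n (top_mix n r w k)"
  unfolding symmetric_on_Rn_def top_mix_def by (simp add: top_sum_permute)

lemma monotone_on_Rn_top_mix:
  assumes "\<And>t. t < r \<Longrightarrow> 0 \<le> w t"
  shows "monotone_on_Rn n (top_mix n r w k)"
  unfolding monotone_on_Rn_def top_mix_def
proof (intro ballI impI sum_mono mult_left_mono top_sum_mono)
  fix u v :: "real vec" and i
  assume "\<forall>i<n. 0 \<le> u $ i \<and> u $ i \<le> v $ i" "i < n"
  then have "0 \<le> u $ i" "u $ i \<le> v $ i" by auto
  then show "\<bar>u $ i\<bar> \<le> \<bar>v $ i\<bar>" by simp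
qed (use assms in auto)

lemma sum_inverse_powers_above_le: "(\<Sum>t\<in>{l<..<m}. (1/2::real) ^ t) \<le> (1/2) ^ l"
proof -
  \<comment> \<open>The induction needs the exact value: for \<open>l < m\<close>, the subtracted
    \<open>2 * (1/2)^m\<close> is the geometric tail from \<open>m\<close> on.\<close>
  have "(\<Sum>t\<in>{l<..<m}. (1/2::real) ^ t) \<le> (1/2) ^ l - (if l < m then 2 * (1/2) ^ m else 0)"
  proof (induction m)
    case (Suc m)
    show ?case
    proof (cases "l < m")
      case True
      then have "{l<..<Suc m} = insert m {l<..<m}" by auto
      then show ?thesis using True Suc by simp
    next
      case False
      then have "{l<..<Suc m} = {}" by auto
      then show ?thesis using False by (cases "l = m") auto
    qed
  qed simp
  also have "\<dots> \<le> (1/2) ^ l" by simp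
  finally show ?thesis .
qed

text \<open>The terms \<open>t \<le> l\<close> use that at most \<open>Q\<^sup>t\<close> entries count, the others that at most
  \<open>card C\<close> entries are nonzero.\<close>
lemma top_mix_le_of_support:
  fixes Q :: nat
  assumes "finite C" "\<And>j. j < n \<Longrightarrow> j \<notin> C \<Longrightarrow> u $ j = 0" "\<And>j. j < n \<Longrightarrow> \<bar>u $ j\<bar> \<le> p" "0 \<le> p"
    and Q: "4 \<le> Q" and card_C: "4 * card C \<le> Q ^ Suc l"
  shows "top_mix n r (\<lambda>t. (2 / real Q) ^ t) (\<lambda>t. Q ^ t) u \<le> 3 * 2 ^ l * p"
proof -
  \<comment> \<open>\<open>?b\<close> peaks around \<open>t = l\<close> and decays geometrically on
    both sides. For \<open>t > l\<close> and \<open>d = t - l - 1\<close>, the support bound gives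
    \<open>2^t / (4 * Q^d)\<close>; with \<open>4 \<le> Q\<close> this is at most
    \<open>2^t / 4^(t-l) = 4^l / 2^t\<close>.\<close>
  let ?w = "\<lambda>t. (2 / real Q) ^ t" and ?b = "\<lambda>t. if t \<le> l then 2 ^ t else 4 ^ l * (1/2::real) ^ t"
  have term_le: "?w t * top_sum n (Q ^ t) u \<le> p * ?b t" for t
  proof -
    have top: "top_sum n (Q ^ t) u \<le> p * real (min (Q ^ t) (card C))"
      using assms(1-4) by (rule top_sum_le_of_support)
    have "?w t * real (min (Q ^ t) (card C)) \<le> ?b t"
    proof (cases "t \<le> l")
      case True
      have "?w t * real (min (Q ^ t) (card C)) \<le> ?w t * real (Q ^ t)"
        by (intro mult_left_mono) auto
      also have "\<dots> = 2 ^ t" using Q by (simp add: power_divide)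
      finally show ?thesis using True by simp
    next
      case False
      then obtain d where t: "t = Suc l + d" using less_imp_Suc_add not_le by fastforce
      have "?w t * real (min (Q ^ t) (card C)) \<le> ?w t * (real Q ^ Suc l / 4)"
      proof (intro mult_left_mono)
        have "real (4 * card C) \<le> real (Q ^ Suc l)" using card_C by (rule of_nat_mono)
        then show "real (min (Q ^ t) (card C)) \<le> real Q ^ Suc l / 4" by simp
      qed simp
      also have "\<dots> = 2 ^ t / (4 * real Q ^ d)"
        using Q by (simp add: t power_divide power_add)
      also have "\<dots> \<le> 2 ^ t / (4 * 4 ^ d)"
        using Q by (intro divide_left_mono mult_left_mono power_mono) auto
      also have "\<dots> = 4 ^ l * (1/2) ^ t"
      proof -
        have "(4::real) ^ t = 2 ^ t * 2 ^ t" by (simp flip: power_mult_distrib)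
        moreover have "(4::real) ^ t = 4 ^ l * (4 * 4 ^ d)" by (simp add: t power_add)
        ultimately show ?thesis by (simp add: power_divide field_simps)
      qed
      finally show ?thesis using False by simp
    qed
    then have "p * (?w t * real (min (Q ^ t) (card C))) \<le> p * ?b t"
      using assms(4) by (rule mult_left_mono)
    moreover have "?w t * top_sum n (Q ^ t) u \<le> ?w t * (p * real (min (Q ^ t) (card C)))"
      using top by (intro mult_left_mono) auto
    ultimately show ?thesis by (simp add: mult_ac)
  qed
  \<comment> \<open>Enlarging the index set permits a split at \<open>l\<close> whatever the order
    of \<open>l\<close> and \<open>r\<close>. The lower part is below \<open>2 * 2^l\<close> and the
    upper part at most \<open>2^l\<close>, whence the constant 3.\<close>
  have "(\<Sum>t<r. ?b t) \<le> (\<Sum>t\<in>{..l} \<union> {l<..<r}. ?b t)"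
    by (intro sum_mono2) auto
  also have "\<dots> = (\<Sum>t\<le>l. ?b t) + (\<Sum>t\<in>{l<..<r}. ?b t)"
    by (intro sum.union_disjoint) auto
  also have "(\<Sum>t\<le>l. ?b t) = (\<Sum>t\<le>l. 2 ^ t)" by (intro sum.cong) auto
  also have "\<dots> = 2 * 2 ^ l - 1"
    by (induction l) auto
  also have "(\<Sum>t\<in>{l<..<r}. ?b t) = 4 ^ l * (\<Sum>t\<in>{l<..<r}. (1/2) ^ t)"
    unfolding sum_distrib_left by (intro sum.cong) auto
  also have "\<dots> \<le> 4 ^ l * (1/2) ^ l"
    by (intro mult_left_mono sum_inverse_powers_above_le) simp
  also have "(4::real) ^ l * (1/2) ^ l = 2 ^ l" by (simp flip: power_mult_distrib)
  finally have sum_b: "(\<Sum>t<r. ?b t) \<le> 3 * 2 ^ l" by simp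
  have "top_mix n r ?w (\<lambda>t. Q ^ t) u \<le> (\<Sum>t<r. p * ?b t)"
    unfolding top_mix_def by (intro sum_mono term_le)
  also have "\<dots> = p * (\<Sum>t<r. ?b t)" by (rule sum_distrib_left[symmetric])
  also have "\<dots> \<le> p * (3 * 2 ^ l)" using sum_b assms(4) by (rule mult_left_mono)
  finally show ?thesis by (simp add: mult_ac)
qed

section \<open>The configuration LP\<close>

text \<open>Each machine gives weight \<open>1/r\<close> to each of its \<open>r\<close>
  configurations. By \<open>cover\<close>, every job lies in \<open>r\<close> of them over all
  machines, counted with multiplicity, so it is covered with total weight 1.\<close>

lemma config_lp_feasible_uniformI:
  assumes "0 < r"
    and sub: "\<And>i l. i < n_machines I \<Longrightarrow> l < r \<Longrightarrow> C i l \<subseteq> {..<n_jobs I}"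
    and load: "\<And>i l. i < n_machines I \<Longrightarrow> l < r \<Longrightarrow> set_load I i (C i l) \<le> T"
    and cover: "\<And>j. j < n_jobs I \<Longrightarrow> (\<Sum>i<n_machines I. card {l. l < r \<and> j \<in> C i l}) = r"
  shows "config_lp_feasible I T"
proof -
  \<comment> \<open>Summing over \<open>l\<close> accumulates the weight when several
    \<open>C i l\<close> coincide. A family of sets thus receives the fraction of indices
    \<open>l\<close> with \<open>C i l\<close> in it, and both sums of the LP are instances of
    this.\<close>
  define x where "x i D = (\<Sum>l<r. if C i l = D then 1 / real r else 0)" for i D
  have sum_x: "(\<Sum>D\<in>\<D>. x i D) = real (card {l. l < r \<and> C i l \<in> \<D>}) / real r"
    if "finite \<D>" for i \<D>
  proof -
    have "(\<Sum>D\<in>\<D>. x i D) = (\<Sum>l<r. \<Sum>D\<in>\<D>. if C i l = D then 1 / real r else 0)"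
      unfolding x_def by (rule sum.swap)
    also have "\<dots> = (\<Sum>l<r. if C i l \<in> \<D> then 1 / real r else 0)"
      using that by (simp add: sum.delta)
    also have "\<dots> = (\<Sum>l\<in>{l\<in>{..<r}. C i l \<in> \<D>}. 1 / real r)"
      by (rule sum.inter_filter[symmetric]) simp
    finally show ?thesis by simp
  qed
  show ?thesis
    unfolding config_lp_feasible_def
  proof (intro exI[of _ x] conjI allI impI)
    show "0 \<le> x i D" for i D unfolding x_def by (intro sum_nonneg) auto
    show "(\<Sum>D\<in>Pow {..<n_jobs I}. x i D) \<le> 1" for i
    proof -
      have "card {l. l < r \<and> C i l \<in> Pow {..<n_jobs I}} \<le> card {..<r}"
        by (rule card_mono) auto
      then show ?thesis using assms(1) by (simp add: sum_x)
    qed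
  next
    fix j assume j: "j < n_jobs I"
    have "(\<Sum>i<n_machines I. \<Sum>D\<in>{D \<in> Pow {..<n_jobs I}. j \<in> D}. x i D)
        = (\<Sum>i<n_machines I. real (card {l. l < r \<and> j \<in> C i l}) / real r)"
    proof (rule sum.cong[OF refl])
      fix i assume "i \<in> {..<n_machines I}"
      then have "{l. l < r \<and> C i l \<in> {D \<in> Pow {..<n_jobs I}. j \<in> D}} = {l. l < r \<and> j \<in> C i l}"
        using sub by fastforce
      then show "(\<Sum>D\<in>{D \<in> Pow {..<n_jobs I}. j \<in> D}. x i D)
          = real (card {l. l < r \<and> j \<in> C i l}) / real r"
        by (subst sum_x) auto
    qed
    also have "\<dots> = real (\<Sum>i<n_machines I. card {l. l < r \<and> j \<in> C i l}) / real r"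
      by (simp add: sum_divide_distrib)
    also have "\<dots> = 1" using cover[OF j] assms(1) by simp
    finally show "(\<Sum>i<n_machines I. \<Sum>D\<in>{D \<in> Pow {..<n_jobs I}. j \<in> D}. x i D) = 1" .
  next
    fix i D assume i: "i < n_machines I" and D: "T < set_load I i D"
    then have "C i l \<noteq> D" if "l < r" for l using load[OF i that] by auto
    then show "x i D = 0" unfolding x_def by (intro sum.neutral) auto
  qed
qed

lemma set_load_le_makespan:
  assumes "i < n_machines I"
  shows "set_load I i {j \<in> {..<n_jobs I}. \<rho> j = i} \<le> makespan I \<rho>"
  unfolding makespan_def using assms by (intro Max_ge) auto

lemma set_load_top:
  assumes "j \<in> C" "j < n_jobs I" "ptime I i j = \<infinity>"
  shows "set_load I i C = \<infinity>"
  using assms unfolding set_load_def ext_norm_def by auto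

lemma set_load_finite:
  assumes "\<And>j. j \<in> C \<Longrightarrow> j < n_jobs I \<Longrightarrow> ptime I i j \<noteq> \<infinity>"
  shows "set_load I i C = ennreal (inner_norm I i
           (vec (n_jobs I) (\<lambda>j. if j \<in> C then enn2real (ptime I i j) else 0)))"
proof -
  have "enn2real (if j \<in> C then ptime I i j else 0) = (if j \<in> C then enn2real (ptime I i j) else 0)"
    for j by simp
  then show ?thesis using assms unfolding set_load_def ext_norm_def by auto
qed

section \<open>The gap instance\<close>

text \<open>The jobs \<open>j < n\<^sub>0\<close> carry a class and a set of admissible machines; the remaining ones are
  padding with processing time \<open>0\<close>.\<close>
locale gap_instance =
  fixes r n n\<^sub>0 Q :: nat and cls :: "nat \<Rightarrow> nat" and adm :: "nat \<Rightarrow> nat set"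
  assumes r_pos: "0 < r" and n0_le: "n\<^sub>0 \<le> n" and Q_def: "Q = 32 ^ r"
    and cls_less: "\<And>j. j < n\<^sub>0 \<Longrightarrow> cls j < r"
    and adm_sub: "\<And>j. j < n\<^sub>0 \<Longrightarrow> adm j \<subseteq> {..<2 * r}"
    and card_adm: "\<And>j. j < n\<^sub>0 \<Longrightarrow> card (adm j) = r"
    and card_jobs: "\<And>l e. l < r \<Longrightarrow> e \<subseteq> {..<2 * r} \<Longrightarrow> card e = r \<Longrightarrow>
                      card {j. j < n\<^sub>0 \<and> cls j = l \<and> adm j = e} = r * Q ^ l"
begin

text \<open>The factor \<open>2/3\<close> turns the bound \<open>3 * 2^l * p\<close> of
  \<open>top_mix_le_of_support\<close> into exactly the threshold 2.\<close>

definition size_of :: "nat \<Rightarrow> real" where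
  "size_of j = (if j < n\<^sub>0 then 2/3 * (1/2) ^ cls j else 0)"

definition inst :: gmp_instance where
  "inst = \<lparr>n_jobs = n, n_machines = 2 * r,
     ptime = (\<lambda>i j. if j < n\<^sub>0 \<and> i \<notin> adm j then \<infinity> else ennreal (size_of j)),
     inner_norm = (\<lambda>_. top_mix n r (\<lambda>t. (2 / real Q) ^ t) (\<lambda>t. Q ^ t))\<rparr>"

lemma inst_simps [simp]:
  "n_jobs inst = n" "n_machines inst = 2 * r"
  "ptime inst i j = (if j < n\<^sub>0 \<and> i \<notin> adm j then \<infinity> else ennreal (size_of j))"
  "inner_norm inst i = top_mix n r (\<lambda>t. (2 / real Q) ^ t) (\<lambda>t. Q ^ t)"
  by (simp_all add: inst_def)

lemma size_of_nonneg: "0 \<le> size_of j"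
  by (simp add: size_of_def)

lemma Q_pos: "0 < Q"
  by (simp add: Q_def)

lemma is_gmp_inst: "is_gmp inst"
  unfolding is_gmp_def using r_pos Q_pos
  by (auto intro!: norm_on_Rn_top_mix symmetric_on_Rn_top_mix monotone_on_Rn_top_mix)

lemma set_load_inst:
  assumes "\<And>j. j \<in> C \<Longrightarrow> j < n\<^sub>0 \<Longrightarrow> i \<in> adm j"
  shows "set_load inst i C = ennreal (top_mix n r (\<lambda>t. (2 / real Q) ^ t) (\<lambda>t. Q ^ t)
           (vec n (\<lambda>j. if j \<in> C then size_of j else 0)))"
proof -
  have "set_load inst i C = ennreal (top_mix n r (\<lambda>t. (2 / real Q) ^ t) (\<lambda>t. Q ^ t)
           (vec n (\<lambda>j. if j \<in> C then enn2real (ptime inst i j) else 0)))"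
    using assms by (subst set_load_finite) auto
  moreover have "(if j \<in> C then enn2real (ptime inst i j) else 0) = (if j \<in> C then size_of j else 0)"
    for j using assms size_of_nonneg by auto
  ultimately show ?thesis by presburger
qed

section \<open>Feasibility of the configuration LP with threshold 2\<close>

definition class_jobs :: "nat \<Rightarrow> nat \<Rightarrow> nat set" where
  "class_jobs i l = {j. j < n\<^sub>0 \<and> cls j = l \<and> i \<in> adm j}"

text \<open>This is where the base 32 = 4 * 4 * 2 of \<open>Q\<close> comes from: there are at most
  \<open>4^r\<close> admissible sets, the multiplicity \<open>r\<close> is at most
  \<open>2^r\<close>, and another \<open>4^r\<close> absorbs the factor 4.\<close>

lemma card_class_jobs_le:
  assumes "l < r"
  shows "4 * card (class_jobs i l) \<le> Q ^ Suc l"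
proof -
  let ?E = "{e. e \<subseteq> {..<2 * r} \<and> card e = r}"
  have fin: "finite ?E" by (rule finite_subset[of _ "Pow {..<2 * r}"]) auto
  have "class_jobs i l \<subseteq> (\<Union>e\<in>?E. {j. j < n\<^sub>0 \<and> cls j = l \<and> adm j = e})"
    using adm_sub card_adm unfolding class_jobs_def by blast
  then have "card (class_jobs i l) \<le> card (\<Union>e\<in>?E. {j. j < n\<^sub>0 \<and> cls j = l \<and> adm j = e})"
    using fin by (intro card_mono) auto
  also have "\<dots> \<le> (\<Sum>e\<in>?E. card {j. j < n\<^sub>0 \<and> cls j = l \<and> adm j = e})"
    using fin by (rule card_UN_le)
  also have "\<dots> = (\<Sum>e\<in>?E. r * Q ^ l)"
    using card_jobs[OF assms] by (intro sum.cong) auto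
  also have "\<dots> = card ?E * (r * Q ^ l)" by simp
  also have "card ?E \<le> card (Pow {..<2 * r})" by (rule card_mono) auto
  also have "card (Pow {..<2 * r}) = 4 ^ r" by (simp add: card_Pow power_mult)
  finally have "4 * card (class_jobs i l) \<le> 4 * (4 ^ r * (r * Q ^ l))" by simp
  also have "\<dots> \<le> 4 ^ r * (4 ^ r * (2 ^ r * Q ^ l))"
  proof (intro mult_mono)
    show "(4::nat) \<le> 4 ^ r" using r_pos self_le_power[of "4::nat" r] by simp
    show "r \<le> 2 ^ r" using less_exp[of r] by simp
  qed auto
  also have "\<dots> = Q ^ Suc l"
    by (simp add: Q_def flip: mult.assoc power_mult_distrib)
  finally show ?thesis .
qed

text \<open>The padding goes into every configuration of machine \<open>0\<close>.\<close>
definition config :: "nat \<Rightarrow> nat \<Rightarrow> nat set" where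
  "config i l = class_jobs i l \<union> (if i = 0 then {n\<^sub>0..<n} else {})"

lemma set_load_config_le:
  assumes "l < r"
  shows "set_load inst i (config i l) \<le> 2"
proof -
  let ?u = "vec n (\<lambda>j. if j \<in> config i l then size_of j else 0)"
  have "top_mix n r (\<lambda>t. (2 / real Q) ^ t) (\<lambda>t. Q ^ t) ?u \<le> 3 * 2 ^ l * (2/3 * (1/2) ^ l)"
  proof (rule top_mix_le_of_support)
    \<comment> \<open>The support is taken to be \<open>class_jobs i l\<close> rather than the whole
      configuration, because padding jobs have size 0.\<close>
    show "finite (class_jobs i l)" by (simp add: class_jobs_def)
    show "4 * card (class_jobs i l) \<le> Q ^ Suc l" using assms by (rule card_class_jobs_le)
    have "(32::nat) \<le> 32 ^ r" using r_pos self_le_power[of "32::nat" r] by simp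
    then show "4 \<le> Q" by (simp add: Q_def)
  qed (auto simp: config_def class_jobs_def size_of_def)
  also have "\<dots> = 2" by (simp add: power_divide)
  finally have "ennreal (top_mix n r (\<lambda>t. (2 / real Q) ^ t) (\<lambda>t. Q ^ t) ?u) \<le> ennreal 2"
    by (rule ennreal_leI)
  moreover have "i \<in> adm j" if "j \<in> config i l" "j < n\<^sub>0" for j
    using that by (auto simp: config_def class_jobs_def split: if_splits)
  ultimately show ?thesis by (simp add: set_load_inst)
qed

text \<open>A job \<open>j < n\<^sub>0\<close> lies in one configuration, that of its class, on each
  of its \<open>r\<close> admissible machines; a padding job lies in all \<open>r\<close>
  configurations of machine 0. Both counts are \<open>r\<close>.\<close>

lemma config_lp_feasible_inst: "config_lp_feasible inst 2"
proof (rule config_lp_feasible_uniformI[where C = config and r = r])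
  show "config i l \<subseteq> {..<n_jobs inst}" for i l
    using n0_le by (auto simp: config_def class_jobs_def)
next
  fix j assume j: "j < n_jobs inst"
  show "(\<Sum>i<n_machines inst. card {l. l < r \<and> j \<in> config i l}) = r"
  proof (cases "j < n\<^sub>0")
    case True
    have "{l. l < r \<and> j \<in> config i l} = (if i \<in> adm j then {cls j} else {})" for i
      using True cls_less by (auto simp: config_def class_jobs_def)
    then have "(\<Sum>i<2 * r. card {l. l < r \<and> j \<in> config i l})
        = (\<Sum>i<2 * r. if i \<in> adm j then 1 else 0)"
      by (intro sum.cong) auto
    also have "\<dots> = card ({..<2 * r} \<inter> adm j)" by (simp add: sum.If_cases)
    also have "{..<2 * r} \<inter> adm j = adm j" using adm_sub[OF True] by blast
    finally show ?thesis using card_adm[OF True] by simp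
  next
    case False
    then have "{l. l < r \<and> j \<in> config i l} = (if i = 0 then {..<r} else {})" for i
      using j by (auto simp: config_def class_jobs_def)
    then have "(\<Sum>i<2 * r. card {l. l < r \<and> j \<in> config i l}) = (\<Sum>i<2 * r. if i = 0 then r else 0)"
      by (intro sum.cong) auto
    then show ?thesis using r_pos by simp
  qed
qed (use r_pos set_load_config_le in auto)

section \<open>Lower bound for every assignment\<close>

text \<open>The threshold \<open>Q^l\<close> is the number of entries counted by the summand
  \<open>t = l\<close> of the norm, so a heavy class fills that summand completely.\<close>

definition heavy :: "(nat \<Rightarrow> nat) \<Rightarrow> nat \<Rightarrow> nat \<Rightarrow> bool" where
  "heavy \<rho> i l \<longleftrightarrow> Q ^ l \<le> card {j. j < n\<^sub>0 \<and> cls j = l \<and> \<rho> j = i}"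

text \<open>If at most \<open>r\<close> machines were heavy, some \<open>r\<close>-set
  \<open>e\<close> would avoid them all. The \<open>r * Q^l\<close> jobs of class \<open>l\<close>
  admissible exactly on \<open>e\<close> would then be spread over \<open>r\<close> machines that
  each take fewer than \<open>Q^l\<close>.\<close>

lemma card_heavy_machines_gt:
  assumes adm: "\<And>j. j < n\<^sub>0 \<Longrightarrow> \<rho> j \<in> adm j" and l: "l < r"
  shows "r < card {i. i < 2 * r \<and> heavy \<rho> i l}"
proof (rule ccontr)
  let ?H = "{i. i < 2 * r \<and> heavy \<rho> i l}"
  assume "\<not> r < card ?H"
  moreover have "card ({..<2 * r} - ?H) = 2 * r - card ?H"
    by (subst card_Diff_subset) auto
  ultimately have "r \<le> card ({..<2 * r} - ?H)" by simp
  then obtain e where e: "e \<subseteq> {..<2 * r} - ?H" "card e = r" "finite e"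
    by (rule obtain_subset_with_card_n)
  let ?J = "{j. j < n\<^sub>0 \<and> cls j = l \<and> adm j = e}"
  have "?J \<subseteq> (\<Union>i\<in>e. {j. j < n\<^sub>0 \<and> cls j = l \<and> \<rho> j = i})" using adm by auto
  then have "card ?J \<le> card (\<Union>i\<in>e. {j. j < n\<^sub>0 \<and> cls j = l \<and> \<rho> j = i})"
    using e by (intro card_mono) auto
  also have "\<dots> \<le> (\<Sum>i\<in>e. card {j. j < n\<^sub>0 \<and> cls j = l \<and> \<rho> j = i})"
    using e(3) by (rule card_UN_le)
  also have "\<dots> < (\<Sum>i\<in>e. Q ^ l)"
  proof (rule sum_strict_mono)
    show "e \<noteq> {}" using e r_pos by auto
    show "card {j. j < n\<^sub>0 \<and> cls j = l \<and> \<rho> j = i} < Q ^ l" if "i \<in> e" for i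
      using that e(1) unfolding heavy_def by auto
  qed (rule e(3))
  also have "\<dots> = r * Q ^ l" using e by simp
  also have "\<dots> = card ?J" using card_jobs[OF l, of e] e(1,2) by fastforce
  finally show False by simp
qed

text \<open>Double counting of heavy pairs: the \<open>r\<close> classes contribute more than
  \<open>r * r\<close> pairs in total, so the \<open>2 * r\<close> machines cannot all be heavy in
  fewer than \<open>r/2\<close> classes.\<close>

lemma exists_machine_heavy_in_half:
  assumes "\<And>j. j < n\<^sub>0 \<Longrightarrow> \<rho> j \<in> adm j"
  obtains i where "i < 2 * r" "r \<le> 2 * card {l. l < r \<and> heavy \<rho> i l}"
proof -
  have "\<exists>i<2 * r. r \<le> 2 * card {l. l < r \<and> heavy \<rho> i l}"
  proof (rule ccontr)
    assume "\<not> ?thesis"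
    then have "(\<Sum>i<2 * r. 2 * card {l. l < r \<and> heavy \<rho> i l}) \<le> (\<Sum>i<2 * r. r)"
      by (intro sum_mono) (auto simp: not_le less_imp_le)
    then have "(\<Sum>i<2 * r. card {l. l < r \<and> heavy \<rho> i l}) \<le> r * r"
      by (simp flip: sum_distrib_left)
    moreover have "(\<Sum>i<2 * r. card {l. l < r \<and> heavy \<rho> i l})
        = (\<Sum>l<r. card {i. i < 2 * r \<and> heavy \<rho> i l})"
      using sum.swap[of "\<lambda>i l. if heavy \<rho> i l then 1 else 0::nat" "{..<r}" "{..<2 * r}"]
      by (simp add: sum.If_cases Int_def)
    moreover have "(\<Sum>l<r. r) < (\<Sum>l<r. card {i. i < 2 * r \<and> heavy \<rho> i l})"
      using r_pos card_heavy_machines_gt[OF assms] by (intro sum_strict_mono) auto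
    ultimately show False by simp
  qed
  then show thesis using that by blast
qed

lemma makespan_inst_ge:
  assumes \<rho>: "\<rho> \<in> assignments inst"
  shows "ennreal (real r / 3) \<le> makespan inst \<rho>"
proof (cases "\<forall>j<n\<^sub>0. \<rho> j \<in> adm j")
  \<comment> \<open>One job on an inadmissible machine already makes that load infinite; the
    counting argument concerns the remaining assignments.\<close>
  case False
  then obtain j where j: "j < n\<^sub>0" "\<rho> j \<notin> adm j" by blast
  let ?C = "{j' \<in> {..<n_jobs inst}. \<rho> j' = \<rho> j}"
  have "set_load inst (\<rho> j) ?C = \<infinity>"
    using j n0_le by (intro set_load_top[of j]) auto
  moreover have "\<rho> j < n_machines inst"
    using \<rho> j n0_le unfolding assignments_def by auto
  ultimately show ?thesis using set_load_le_makespan[of "\<rho> j" inst \<rho>] by (simp add: top_unique)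
next
  case True
  then obtain i where i: "i < 2 * r" and half: "r \<le> 2 * card {l. l < r \<and> heavy \<rho> i l}"
    using exists_machine_heavy_in_half by blast
  let ?S = "{l. l < r \<and> heavy \<rho> i l}" and ?C = "{j \<in> {..<n}. \<rho> j = i}"
  let ?u = "vec n (\<lambda>j. if j \<in> ?C then size_of j else 0)"
  let ?f = "\<lambda>l. (2 / real Q) ^ l * top_sum n (Q ^ l) ?u"
  \<comment> \<open>Class \<open>l\<close> is charged to the summand \<open>t = l\<close> only,
    where \<open>Q^l\<close> jobs give \<open>(2/Q)^l * Q^l * (2/3) * (1/2)^l = 2/3\<close>.
    Different classes use different summands, so at least \<open>r/2\<close> heavy classes add up to
    \<open>r/3\<close>.\<close>
  have ge: "2/3 \<le> ?f l" if "l \<in> ?S" for l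
  proof -
    have "Q ^ l \<le> card {j. j < n\<^sub>0 \<and> cls j = l \<and> \<rho> j = i}"
      using that by (simp add: heavy_def)
    then obtain K where K: "K \<subseteq> {j. j < n\<^sub>0 \<and> cls j = l \<and> \<rho> j = i}" "card K = Q ^ l"
      by (rule obtain_subset_with_card_n)
    have "2/3 = (2 / real Q) ^ l * (real (Q ^ l) * (2/3 * (1/2) ^ l))"
      using Q_pos by (simp add: power_divide)
    also have "real (Q ^ l) * (2/3 * (1/2) ^ l) = (\<Sum>j\<in>K. 2/3 * (1/2) ^ l)"
      using K by simp
    also have "\<dots> = (\<Sum>j\<in>K. \<bar>?u $ j\<bar>)"
    proof (rule sum.cong[OF refl])
      fix j assume "j \<in> K"
      then have "j < n\<^sub>0" "cls j = l" "\<rho> j = i" using K by auto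
      then show "2/3 * (1/2) ^ l = \<bar>?u $ j\<bar>" using n0_le by (simp add: size_of_def)
    qed
    also have "\<dots> \<le> top_sum n (Q ^ l) ?u"
      using K n0_le by (intro sum_le_top_sum) auto
    finally show ?thesis by (simp add: mult_left_mono)
  qed
  have "real r / 3 \<le> (\<Sum>l\<in>?S. 2/3)" using half by simp
  also have "\<dots> \<le> (\<Sum>l\<in>?S. ?f l)" by (intro sum_mono ge)
  also have "\<dots> \<le> (\<Sum>l<r. ?f l)"
    by (intro sum_mono2) (auto intro!: mult_nonneg_nonneg top_sum_nonneg)
  finally have "ennreal (real r / 3) \<le> set_load inst i ?C"
    using True by (subst set_load_inst) (auto simp: top_mix_def intro!: ennreal_leI)
  also have "\<dots> \<le> makespan inst \<rho>" using set_load_le_makespan[of i inst \<rho>] i by simp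
  finally show ?thesis .
qed

end

section \<open>Construction of the job system\<close>

text \<open>Jobs are triples of a class, an \<open>r\<close>-set of machines and a copy number.
  Enumerating these triples by \<open>g\<close> makes \<open>cls\<close> and \<open>adm\<close>
  projections, and the jobs of a given class and \<open>r\<close>-set correspond to the copy
  numbers.\<close>

lemma gap_instance_exists:
  assumes r: "0 < r" and n: "2 ^ (9 * r\<^sup>2) \<le> n"
  obtains n\<^sub>0 cls adm where "gap_instance r n n\<^sub>0 (32 ^ r) cls adm"
proof -
  define E where "E = {e. e \<subseteq> {..<2 * r} \<and> card e = r}"
  define q where "q l = r * (32 ^ r) ^ l" for l :: nat
  define D where "D = (SIGMA l:{..<r}. E \<times> {..<q l})"
  have finE: "finite E" unfolding E_def by (rule finite_subset[of _ "Pow {..<2 * r}"]) auto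
  then have finD: "finite D" by (auto simp: D_def)
  then obtain g where g: "bij_betw g {0..<card D} D" using ex_bij_betw_nat_finite by blast
  let ?cls = "\<lambda>j. fst (g j)" and ?adm = "\<lambda>j. fst (snd (g j))"
  have gD: "g j \<in> D" if "j < card D" for j
    using g that by (auto simp: bij_betw_def)
  \<comment> \<open>There are at most \<open>2^r\<close> classes, \<open>2^(2*r)\<close> machine
    sets and \<open>2^r * 2^(5*r*r)\<close> copies for each pair. The exponents sum to
    \<open>4*r + 5*r*r\<close>, at most \<open>9*r*r\<close>.\<close>
  have "card D \<le> n"
  proof -
    have "card E \<le> card (Pow {..<2 * r})" unfolding E_def by (rule card_mono) auto
    then have cardE: "card E \<le> 2 ^ (2 * r)" by (simp add: card_Pow)
    have r_le: "r \<le> 2 ^ r" using less_exp[of r] by simp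
    have "card D = (\<Sum>l<r. card E * q l)" unfolding D_def using finE by simp
    also have "\<dots> \<le> (\<Sum>l<r. 2 ^ (2 * r) * (2 ^ r * 2 ^ (5 * r * r)))"
    proof (intro sum_mono mult_mono cardE)
      fix l assume "l \<in> {..<r}"
      then have "(32 ^ r) ^ l \<le> ((32::nat) ^ r) ^ r" by (intro power_increasing) auto
      also have "((32::nat) ^ r) ^ r = ((2 ^ 5) ^ r) ^ r" by simp
      also have "\<dots> = 2 ^ (5 * r * r)" by (simp only: power_mult)
      finally have "(32 ^ r) ^ l \<le> (2::nat) ^ (5 * r * r)" by simp
      then show "q l \<le> 2 ^ r * 2 ^ (5 * r * r)"
        unfolding q_def by (intro mult_mono r_le) auto
    qed auto
    also have "\<dots> \<le> 2 ^ r * (2 ^ (2 * r) * (2 ^ r * 2 ^ (5 * r * r)))"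
      using r_le by simp
    also have "\<dots> = 2 ^ (r + (2 * r + (r + 5 * r * r)))" by (simp only: power_add)
    also have "\<dots> \<le> 2 ^ (9 * r\<^sup>2)"
    proof (intro power_increasing)
      have "r * 1 \<le> r * r" using r by (intro mult_left_mono) auto
      then show "r + (2 * r + (r + 5 * r * r)) \<le> 9 * r\<^sup>2" by (simp add: power2_eq_square)
    qed auto
    finally show ?thesis using n by simp
  qed
  moreover have "card {j. j < card D \<and> ?cls j = l \<and> ?adm j = e} = r * (32 ^ r) ^ l"
    if "l < r" "e \<subseteq> {..<2 * r}" "card e = r" for l e
  proof -
    let ?J = "{j. j < card D \<and> ?cls j = l \<and> ?adm j = e}"
    have img: "g ` ?J = {l} \<times> {e} \<times> {..<q l}"
    proof
      show "g ` ?J \<subseteq> {l} \<times> {e} \<times> {..<q l}"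
      proof
        fix y assume "y \<in> g ` ?J"
        then obtain j where "j \<in> ?J" "y = g j" by blast
        then show "y \<in> {l} \<times> {e} \<times> {..<q l}"
          using gD[of j] by (cases "g j") (auto simp: D_def)
      qed
      show "{l} \<times> {e} \<times> {..<q l} \<subseteq> g ` ?J"
      proof
        fix y assume y: "y \<in> {l} \<times> {e} \<times> {..<q l}"
        then have "y \<in> D" using that by (auto simp: D_def E_def)
        then have "y \<in> g ` {0..<card D}" using g by (simp add: bij_betw_def)
        then obtain j where j: "j < card D" "y = g j" by auto
        have "fst y = l" "fst (snd y) = e" using y by auto
        then have "j \<in> ?J" using j by simp
        then show "y \<in> g ` ?J" using j(2) by (rule rev_image_eqI)
      qed
    qed
    have "inj_on g ?J"
      using g by (auto simp: bij_betw_def intro: inj_on_subset)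
    then have "card (g ` ?J) = card ?J" by (rule card_image)
    then have "card ?J = card ({l} \<times> {e} \<times> {..<q l})" unfolding img by (rule sym)
    then show ?thesis by (simp add: q_def)
  qed
  moreover have "?cls j < r" "?adm j \<subseteq> {..<2 * r}" "card (?adm j) = r" if "j < card D" for j
    using gD[OF that] by (auto simp: D_def E_def)
  ultimately have "gap_instance r n (card D) (32 ^ r) ?cls ?adm"
    using r by (intro gap_instance.intro refl)
  then show thesis by (rule that)
qed

section \<open>The integrality gap\<close>

text \<open>The greatest \<open>r\<close> with \<open>2^(9*r*r) \<le> n\<close> works. It is
  positive because \<open>512 = 2^9\<close>, and its maximality bounds \<open>ln n\<close> by a
  multiple of the square of \<open>r\<close>.\<close>

lemma exists_quadratic_exponent:
  assumes "512 \<le> n"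
  obtains r where "0 < r" "2 ^ (9 * r\<^sup>2) \<le> n" "1/18 * sqrt (ln (real n)) \<le> real r / 3"
proof -
  let ?P = "\<lambda>r. 2 ^ (9 * r\<^sup>2) \<le> n"
  have bound: "r \<le> n" if "?P r" for r
  proof -
    have "r \<le> 9 * r\<^sup>2" by (simp add: power2_eq_square)
    also have "\<dots> < 2 ^ (9 * r\<^sup>2)" by (rule less_exp)
    finally show ?thesis using that by simp
  qed
  define r where "r = Greatest ?P"
  have P1: "?P 1" using assms by simp
  have Pr: "?P r" unfolding r_def using P1 bound by (rule GreatestI_nat)
  have r1: "1 \<le> r" unfolding r_def using P1 bound by (rule Greatest_le_nat)
  have "\<not> ?P (Suc r)"
    using Greatest_le_nat[of ?P "Suc r" n] bound unfolding r_def by fastforce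
  then have "real n \<le> real (2 ^ (9 * (Suc r)\<^sup>2))" by (intro of_nat_mono) simp
  then have "ln (real n) \<le> ln (2 ^ (9 * (Suc r)\<^sup>2))" using assms by (subst ln_le_cancel_iff) auto
  also have "\<dots> = real (9 * (Suc r)\<^sup>2) * ln 2" by (rule ln_realpow)
  also have "\<dots> \<le> real (9 * (Suc r)\<^sup>2) * 1" using ln_2_less_1 by (intro mult_left_mono) auto
  \<comment> \<open>From \<open>r + 1 \<le> 2 * r\<close> the root of \<open>ln n\<close> is at most
    \<open>6 * r\<close>, and \<open>1/18\<close> times this is \<open>r/3\<close>.\<close>
  also have "\<dots> \<le> real (9 * (2 * r)\<^sup>2)"
    using r1 by (simp only: mult_1_right of_nat_le_iff) (intro mult_left_mono power_mono, auto)
  also have "\<dots> = (6 * real r)\<^sup>2" by (simp add: power_mult_distrib)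
  finally have "sqrt (ln (real n)) \<le> 6 * real r" by (intro real_le_lsqrt) auto
  then show thesis using that[of r] r1 Pr by simp
qed

lemma ennreal_inverse_antimono: "x \<le> y \<Longrightarrow> inverse y \<le> inverse x" for x y :: ennreal
  including ennreal.lifting by transfer (rule ereal_inverse_antimono)

lemma config_lp_gap_ge:
  assumes "is_gmp I" "n_jobs I = n" "config_lp_feasible I 2"
    and "\<And>\<rho>. \<rho> \<in> assignments I \<Longrightarrow> ennreal b \<le> makespan I \<rho>" "0 \<le> b"
  shows "ennreal (b / 2) \<le> config_lp_gap n"
proof -
  have "ennreal b \<le> opt_makespan I"
    unfolding opt_makespan_def using assms(4) by (rule INF_greatest)
  moreover have "config_lp_bound I \<le> 2"
    unfolding config_lp_bound_def using assms(3) by (intro Inf_lower) simp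
  \<comment> \<open>Division is multiplication by the inverse, which is antitone on all of
    \<open>ennreal\<close>; thus zero or infinite bounds need no separate case.\<close>
  ultimately have "ennreal b / 2 \<le> opt_makespan I / config_lp_bound I"
    unfolding divide_ennreal_def by (intro mult_mono ennreal_inverse_antimono) auto
  also have "\<dots> \<le> config_lp_gap n"
    unfolding config_lp_gap_def using assms(1,2) by (intro SUP_upper) simp
  finally show ?thesis using assms(5) divide_ennreal[of b 2] by simp
qed

theorem theorem1:
  "(\<exists>c::real. c > 0 \<and>
      (\<forall>\<^sub>F n in sequentially. \<exists>I. is_gmp I \<and> n_jobs I = n \<and>
         (\<exists>\<psi>. \<forall>i<n_machines I. inner_norm I i = \<psi>) \<and>
         config_lp_feasible I 2 \<and>
         (\<forall>\<rho>\<in>assignments I. ennreal (c * sqrt (ln (real n))) \<le> makespan I \<rho>))) \<and>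
   (\<exists>c::real. c > 0 \<and>
      (\<forall>\<^sub>F n in sequentially. ennreal (c * sqrt (ln (real n))) \<le> config_lp_gap n))"
proof -
  have inst: "\<exists>I. is_gmp I \<and> n_jobs I = n \<and> (\<exists>\<psi>. \<forall>i<n_machines I. inner_norm I i = \<psi>) \<and>
      config_lp_feasible I 2 \<and>
      (\<forall>\<rho>\<in>assignments I. ennreal (1/18 * sqrt (ln (real n))) \<le> makespan I \<rho>)"
    if n: "512 \<le> n" for n :: nat
  proof -
    obtain r where r: "0 < r" "2 ^ (9 * r\<^sup>2) \<le> n" "1/18 * sqrt (ln (real n)) \<le> real r / 3"
      using n by (rule exists_quadratic_exponent)
    obtain n\<^sub>0 cls adm where "gap_instance r n n\<^sub>0 (32 ^ r) cls adm"
      using r(1,2) by (rule gap_instance_exists)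
    then interpret gap_instance r n n\<^sub>0 "32 ^ r" cls adm .
    have "ennreal (1/18 * sqrt (ln (real n))) \<le> makespan inst \<rho>" if "\<rho> \<in> assignments inst" for \<rho>
      using ennreal_leI[OF r(3)] makespan_inst_ge[OF that] by (rule order_trans)
    then show ?thesis
      using is_gmp_inst config_lp_feasible_inst by (intro exI[of _ inst]) auto
  qed
  \<comment> \<open>The constant \<open>1/18\<close> is halved because the gap divides by the LP
    bound, which is at most 2.\<close>
  have "ennreal (1/36 * sqrt (ln (real n))) \<le> config_lp_gap n" if n: "512 \<le> n" for n :: nat
  proof -
    obtain I where "is_gmp I" "n_jobs I = n" "config_lp_feasible I 2"
      "\<And>\<rho>. \<rho> \<in> assignments I \<Longrightarrow> ennreal (1/18 * sqrt (ln (real n))) \<le> makespan I \<rho>"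
      using inst[OF n] by blast
    then have "ennreal (1/18 * sqrt (ln (real n)) / 2) \<le> config_lp_gap n"
      using n by (intro config_lp_gap_ge) auto
    then show ?thesis by simp
  qed
  with inst show ?thesis
    unfolding eventually_sequentially
    by (intro conjI exI[of _ "1/18"] exI[of _ "1/36"] exI[of _ "512"]) auto
qed

end
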